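(* Let $0<d_k<1$, let $n\ge 1$, $n_1\ge 1$, $m\ge0$, $m_1\ge 1$ be integers, and let $c_1,c_2$ be nonzero real numbers having the same sign. Consider a function (assumed well defined, i.e. with non-vanishing denominator, on $[d_k,1]$) $$f(\omega)=d_k+\frac{(\omega-d_k)^{n+1}}{(\omega-d_k)^n+c_2(\omega-d_k)^{n_1}(1-\omega)^{m_1}+c_1(1-\omega)^{m+1}},\qquad \omega\in[d_k,1].$$ Then $f$ satisfies the condition $C_{n,\min(m,\,m_1-1)}$ on $[d_k,1]$.
   Context: Condition $C_{n,M}$ on $[d_k,1]$ (for $0<d_k<1$ and integers $n\ge1$, $M\ge0$): a function $g$ on $[d_k,1]$ satisfies $C_{n,M}$ if (derivatives at the endpoints being one-sided, within $[d_k,1]$) (i) $g(d_k)=d_k$, $g^{(i)}(d_k)=0$ for $1\le i\le n$, and $g^{(n+1)}(d_k)\neq 0$; (ii) $g(1)=1$; if $M\ge 1$ then $g'(1)=1$; $g^{(i)}(1)=0$ for $2\le i\le M$; and $g^{(M+1)}(1)\ne 0$. (In particular, for $M=0$ condition (ii) reads $g(1)=1$ and $g'(1)\neq0$.) *)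

theory Defs
  imports "HOL-Analysis.Analysis"
begin

text \<open>The \<open>i\<close>-th derivative of \<open>g\<close>, all difference quotients being taken within \<open>S\<close>; for an interval
  this is one-sided at its endpoints and depends only on the values of \<open>g\<close> on the interval. The
  value is only meaningful where the derivative exists, see \<open>times_differentiable_within\<close>.\<close>

definition nth_deriv_within :: "nat \<Rightarrow> (real \<Rightarrow> real) \<Rightarrow> real set \<Rightarrow> real \<Rightarrow> real" where
  "nth_deriv_within i g S = ((\<lambda>h x. vector_derivative h (at x within S)) ^^ i) g"

text \<open>Existence of the first \<open>k\<close> derivatives at the point \<open>a \<in> S\<close>. The derivative of order \<open>k\<close> has
  to exist at all points of \<open>S\<close> near \<open>a\<close> before it can be differentiated at \<open>a\<close>.\<close>

primrec times_differentiable_within :: "nat \<Rightarrow> (real \<Rightarrow> real) \<Rightarrow> real set \<Rightarrow> real \<Rightarrow> bool" where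
  "times_differentiable_within 0 g S a \<longleftrightarrow> True"
| "times_differentiable_within (Suc k) g S a \<longleftrightarrow>
     (\<forall>\<^sub>F x in nhds a. x \<in> S \<longrightarrow> times_differentiable_within k g S x) \<and>
     nth_deriv_within k g S differentiable (at a within S)"

definition condition_C :: "nat \<Rightarrow> nat \<Rightarrow> real \<Rightarrow> (real \<Rightarrow> real) \<Rightarrow> bool" where
  "condition_C n M d g \<longleftrightarrow>
     times_differentiable_within (n + 1) g {d..1} d \<and>
     g d = d \<and>
     (\<forall>i\<in>{1..n}. nth_deriv_within i g {d..1} d = 0) \<and>
     nth_deriv_within (n + 1) g {d..1} d \<noteq> 0 \<and>
     times_differentiable_within (M + 1) g {d..1} 1 \<and>
     g 1 = 1 \<and>
     (M \<ge> 1 \<longrightarrow> nth_deriv_within 1 g {d..1} 1 = 1) \<and>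
     (\<forall>i\<in>{2..M}. nth_deriv_within i g {d..1} 1 = 0) \<and>
     nth_deriv_within (M + 1) g {d..1} 1 \<noteq> 0"

end

theory Submission imports Defs begin

text \<open>Write \<open>D\<close> for the denominator. Everything rests on two factorisations in which the second
  factor is a rational function without poles on \<open>[d, 1]\<close>:

  \<open>f w - d = (w - d) ^ (n + 1) * (1 / D w)\<close> and
  \<open>f w - w = (w - 1) ^ (M + 1) * h w\<close> with \<open>M = min m (m1 - 1)\<close>.

  The second one holds because \<open>(w - d) ^ n - D w\<close> consists of the two terms carrying the powers
  \<open>m1\<close> and \<open>m + 1\<close> of \<open>1 - w\<close>, the smaller of which is \<open>M + 1\<close>. By Taylor's formula
  (\<open>nth_deriv_within_taylor\<close>) the derivatives of \<open>f\<close> at \<open>d\<close> are those of the constant \<open>d\<close> up to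
  order \<open>n\<close>, and the derivatives at \<open>1\<close> are those of the identity up to order \<open>M\<close>. The next
  derivative is corrected by a factorial times \<open>1 / D d\<close> or \<open>h 1\<close>, respectively, so the signs of
  these numbers decide.

  As \<open>D 1 = (1 - d) ^ n > 0\<close> and \<open>D d = c1 * (1 - d) ^ (m + 1)\<close>, the intermediate value theorem
  forces \<open>c1 > 0\<close> when \<open>D\<close> has no zero, hence also \<open>c2 > 0\<close>. It follows that \<open>(- 1) ^ M * h 1 > 0\<close>:
  there is no cancellation between the two terms if \<open>m1 = m + 1\<close>, and none between \<open>h 1\<close> and the
  derivative \<open>1\<close> of the identity if \<open>M = 0\<close>.\<close>

section \<open>Rational functions without poles\<close>

text \<open>The values outside \<open>S\<close> are left open, so that every function agreeing on \<open>S\<close> with a rational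
  one qualifies; derivatives within \<open>S\<close> do not see the difference.\<close>

definition rational_on :: "real set \<Rightarrow> (real \<Rightarrow> real) \<Rightarrow> bool" where
  "rational_on S g \<longleftrightarrow> (\<exists>p q. \<forall>x\<in>S. poly q x \<noteq> 0 \<and> g x = poly p x / poly q x)"

lemma rational_onI:
  "(\<And>x. x \<in> S \<Longrightarrow> poly q x \<noteq> 0) \<Longrightarrow> (\<And>x. x \<in> S \<Longrightarrow> g x = poly p x / poly q x) \<Longrightarrow> rational_on S g"
  unfolding rational_on_def by blast

lemma rational_onE:
  assumes "rational_on S g"
  obtains p q where "\<And>x. x \<in> S \<Longrightarrow> poly q x \<noteq> 0" "\<And>x. x \<in> S \<Longrightarrow> g x = poly p x / poly q x"
  using assms unfolding rational_on_def by blast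

lemma rational_on_cong:
  "rational_on S h \<Longrightarrow> (\<And>x. x \<in> S \<Longrightarrow> g x = h x) \<Longrightarrow> rational_on S g"
  unfolding rational_on_def by metis

lemma rational_on_const: "rational_on S (\<lambda>x. c)"
  by (rule rational_onI[where p = "[:c:]" and q = 1]) auto

lemma rational_on_ident: "rational_on S (\<lambda>x. x)"
  by (rule rational_onI[where p = "[:0, 1:]" and q = 1]) auto

lemma rational_on_add:
  assumes "rational_on S g" "rational_on S h"
  shows "rational_on S (\<lambda>x. g x + h x)"
proof -
  obtain p q where g: "\<And>x. x \<in> S \<Longrightarrow> poly q x \<noteq> 0" "\<And>x. x \<in> S \<Longrightarrow> g x = poly p x / poly q x"
    by (rule rational_onE[OF assms(1)]) blast
  obtain r s where h: "\<And>x. x \<in> S \<Longrightarrow> poly s x \<noteq> 0" "\<And>x. x \<in> S \<Longrightarrow> h x = poly r x / poly s x"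
    by (rule rational_onE[OF assms(2)]) blast
  show ?thesis
    by (rule rational_onI[where p = "p * s + r * q" and q = "q * s"])
      (simp_all add: g h add_frac_eq)
qed

lemma rational_on_mult:
  assumes "rational_on S g" "rational_on S h"
  shows "rational_on S (\<lambda>x. g x * h x)"
proof -
  obtain p q where g: "\<And>x. x \<in> S \<Longrightarrow> poly q x \<noteq> 0" "\<And>x. x \<in> S \<Longrightarrow> g x = poly p x / poly q x"
    by (rule rational_onE[OF assms(1)]) blast
  obtain r s where h: "\<And>x. x \<in> S \<Longrightarrow> poly s x \<noteq> 0" "\<And>x. x \<in> S \<Longrightarrow> h x = poly r x / poly s x"
    by (rule rational_onE[OF assms(2)]) blast
  show ?thesis
    by (rule rational_onI[where p = "p * r" and q = "q * s"]) (simp_all add: g h)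
qed

lemma rational_on_diff:
  assumes "rational_on S g" "rational_on S h"
  shows "rational_on S (\<lambda>x. g x - h x)"
  using rational_on_add[OF assms(1) rational_on_mult[OF rational_on_const[of S "- 1"] assms(2)]]
  by simp

lemma rational_on_power: "rational_on S g \<Longrightarrow> rational_on S (\<lambda>x. g x ^ k)"
  by (induction k) (simp_all add: rational_on_const rational_on_mult)

lemma rational_on_inverse:
  assumes "rational_on S g" "\<And>x. x \<in> S \<Longrightarrow> g x \<noteq> 0"
  shows "rational_on S (\<lambda>x. inverse (g x))"
proof -
  obtain p q where g: "\<And>x. x \<in> S \<Longrightarrow> poly q x \<noteq> 0" "\<And>x. x \<in> S \<Longrightarrow> g x = poly p x / poly q x"
    by (rule rational_onE[OF assms(1)]) blast
  show ?thesis
  proof (rule rational_onI[where p = q and q = p])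
    show "poly p x \<noteq> 0" if "x \<in> S" for x
      using assms(2)[OF that] g(2)[OF that] by auto
  qed (simp add: g)
qed

lemma rational_on_divide:
  assumes "rational_on S g" "rational_on S h" "\<And>x. x \<in> S \<Longrightarrow> h x \<noteq> 0"
  shows "rational_on S (\<lambda>x. g x / h x)"
  unfolding divide_inverse by (intro rational_on_mult rational_on_inverse assms)

lemmas rational_on_intros =
  rational_on_const rational_on_ident rational_on_add rational_on_diff rational_on_mult
  rational_on_power rational_on_divide

text \<open>The quotient rule \<open>(p / q)' = (p' * q - p * q') / q\<^sup>2\<close> keeps the poles away from \<open>S\<close>; this is
  why all higher derivatives exist.\<close>

lemma rational_on_has_derivative:
  assumes "rational_on S g"
  obtains g' where "rational_on S g'"
    "\<And>x. x \<in> S \<Longrightarrow> (g has_vector_derivative g' x) (at x within S)"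
proof -
  obtain p q where g: "\<And>x. x \<in> S \<Longrightarrow> poly q x \<noteq> 0" "\<And>x. x \<in> S \<Longrightarrow> g x = poly p x / poly q x"
    by (rule rational_onE[OF assms]) blast
  define g' where
    "g' x = (poly (pderiv p) x * poly q x - poly p x * poly (pderiv q) x) / (poly q x * poly q x)"
    for x
  have "rational_on S g'"
    by (rule rational_onI[where p = "pderiv p * q - p * pderiv q" and q = "q * q"])
      (simp_all add: g g'_def)
  moreover have "(g has_vector_derivative g' x) (at x within S)" if x: "x \<in> S" for x
  proof -
    have "((\<lambda>x. poly p x / poly q x) has_field_derivative g' x) (at x within S)"
      unfolding g'_def
      by (intro DERIV_divide has_field_derivative_at_within[OF poly_DERIV] g(1) x)
    then have "((\<lambda>x. poly p x / poly q x) has_vector_derivative g' x) (at x within S)"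
      by (simp add: has_real_derivative_iff_has_vector_derivative)
    then show ?thesis
      by (rule has_vector_derivative_transform[OF x g(2), rotated]) simp
  qed
  ultimately show thesis by (rule that)
qed

section \<open>Iterated derivatives within an interval\<close>

lemma nth_deriv_within_0: "nth_deriv_within 0 g S = g"
  by (simp add: nth_deriv_within_def)

lemma nth_deriv_within_Suc:
  "nth_deriv_within (Suc i) g S =
     (\<lambda>x. vector_derivative (nth_deriv_within i g S) (at x within S))"
  by (simp add: nth_deriv_within_def)

lemma nth_deriv_within_Suc_inner:
  "nth_deriv_within (Suc i) g S =
     nth_deriv_within i (\<lambda>x. vector_derivative g (at x within S)) S"
  unfolding nth_deriv_within_def by (simp only: funpow_Suc_right o_apply)

lemma rational_on_vector_derivative:
  assumes "a < b" "rational_on {a..b} g"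
  shows "rational_on {a..b} (\<lambda>x. vector_derivative g (at x within {a..b}))"
    and "x \<in> {a..b} \<Longrightarrow>
      (g has_vector_derivative vector_derivative g (at x within {a..b})) (at x within {a..b})"
proof -
  obtain g' where g': "rational_on {a..b} g'"
    "\<And>x. x \<in> {a..b} \<Longrightarrow> (g has_vector_derivative g' x) (at x within {a..b})"
    by (rule rational_on_has_derivative[OF assms(2)]) blast
  have eq: "vector_derivative g (at x within {a..b}) = g' x" if "x \<in> {a..b}" for x
    using vector_derivative_within_cbox[of a b x g "g' x"] g'(2)[OF that] that assms(1)
    by (simp add: cbox_interval)
  show "rational_on {a..b} (\<lambda>x. vector_derivative g (at x within {a..b}))"
    by (rule rational_on_cong[OF g'(1) eq])
  show "(g has_vector_derivative vector_derivative g (at x within {a..b})) (at x within {a..b})"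
    if "x \<in> {a..b}"
    using g'(2)[OF that] eq[OF that] by simp
qed

lemma rational_on_nth_deriv_within:
  "a < b \<Longrightarrow> rational_on {a..b} g \<Longrightarrow> rational_on {a..b} (nth_deriv_within i g {a..b})"
  by (induction i) (simp_all add: nth_deriv_within_0 nth_deriv_within_Suc rational_on_vector_derivative)

lemma times_differentiable_within_rational:
  assumes "a < b" "rational_on {a..b} g" "x \<in> {a..b}"
  shows "times_differentiable_within k g {a..b} x"
  using assms(3)
proof (induction k arbitrary: x)
  case (Suc k)
  have "nth_deriv_within k g {a..b} differentiable (at x within {a..b})"
    using rational_on_vector_derivative(2)[OF assms(1)
        rational_on_nth_deriv_within[OF assms(1,2)] Suc.prems]
    by (rule differentiableI_vector)
  with Suc.IH show ?case by simp
qed simp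

text \<open>Taylor's formula read backwards: an expansion with remainder \<open>(x - c) ^ k * h x\<close> determines the
  derivatives at \<open>c\<close> up to order \<open>k\<close>. For the induction, differentiating the remainder gives
  \<open>(x - c) ^ (k - 1) * (k * h x + (x - c) * h' x)\<close>, whose new cofactor is again rational and has
  the value \<open>k * h c\<close> at \<open>c\<close>; these factors accumulate to the factorial.\<close>

lemma nth_deriv_within_taylor:
  assumes "a < b" "c \<in> {a..b}" "rational_on {a..b} h"
    and "\<And>x. x \<in> {a..b} \<Longrightarrow> g x = poly p x + (x - c) ^ k * h x"
    and "i \<le> k"
  shows "nth_deriv_within i g {a..b} c =
    poly ((pderiv ^^ i) p) c + (if i = k then fact k * h c else 0)"
  using assms(3-5)
proof (induction k arbitrary: g h p i)
  case 0
  then show ?case using assms(2) by (simp add: nth_deriv_within_0)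
next
  case (Suc k)
  show ?case
  proof (cases i)
    case 0
    then show ?thesis using assms(2) Suc.prems(2) by (simp add: nth_deriv_within_0)
  next
    case (Suc j)
    let ?S = "{a..b}"
    let ?dh = "\<lambda>x. vector_derivative h (at x within ?S)"
    let ?h1 = "\<lambda>x. real (Suc k) * h x + (x - c) * ?dh x"
    have h1: "rational_on ?S ?h1"
      by (intro rational_on_intros rational_on_vector_derivative assms(1) Suc.prems(1))
    have deriv: "vector_derivative g (at x within ?S) = poly (pderiv p) x + (x - c) ^ k * ?h1 x"
      if x: "x \<in> ?S" for x
    proof -
      have dh: "(h has_field_derivative ?dh x) (at x within ?S)"
        using rational_on_vector_derivative(2)[OF assms(1) Suc.prems(1) x]
        by (simp add: has_real_derivative_iff_has_vector_derivative)
      have dp: "(poly p has_field_derivative poly (pderiv p) x) (at x within ?S)"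
        by (rule has_field_derivative_at_within[OF poly_DERIV])
      have "((\<lambda>x. poly p x + (x - c) ^ Suc k * h x) has_field_derivative
          poly (pderiv p) x + (x - c) ^ k * ?h1 x) (at x within ?S)"
        by (rule derivative_eq_intros dh dp refl | simp add: algebra_simps)+
      then have "((\<lambda>x. poly p x + (x - c) ^ Suc k * h x) has_vector_derivative
          poly (pderiv p) x + (x - c) ^ k * ?h1 x) (at x within ?S)"
        by (simp only: has_real_derivative_iff_has_vector_derivative)
      then have "(g has_vector_derivative poly (pderiv p) x + (x - c) ^ k * ?h1 x) (at x within ?S)"
        by (rule has_vector_derivative_transform[OF x Suc.prems(2), rotated]) simp
      then show ?thesis
        using vector_derivative_within_cbox[of a b x g] x assms(1) by (simp add: cbox_interval)
    qed
    have "nth_deriv_within j (\<lambda>x. vector_derivative g (at x within ?S)) ?S c =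
        poly ((pderiv ^^ j) (pderiv p)) c + (if j = k then fact k * ?h1 c else 0)"
      by (rule Suc.IH[OF h1 deriv]) (use Suc Suc.prems(3) in auto)
    then show ?thesis
      using Suc by (simp add: nth_deriv_within_Suc_inner funpow_swap1 algebra_simps)
  qed
qed

section \<open>The family of functions\<close>

text \<open>The denominator is positive at \<open>1\<close> and has the sign of \<open>c1\<close> at \<open>d\<close>, so for \<open>c1 < 0\<close> it would
  vanish somewhere in between.\<close>

lemma coefficient_pos_of_nonvanishing_denominator:
  fixes d c1 c2 :: real
  assumes "d < 1" "n \<ge> 1" "n1 \<ge> 1" "m1 \<ge> 1" "c1 \<noteq> 0"
    and nz: "\<And>w. w \<in> {d..1} \<Longrightarrow>
      (w - d) ^ n + c2 * (w - d) ^ n1 * (1 - w) ^ m1 + c1 * (1 - w) ^ (m + 1) \<noteq> 0"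
  shows "c1 > 0"
proof (rule ccontr)
  let ?D = "\<lambda>w. (w - d) ^ n + c2 * (w - d) ^ n1 * (1 - w) ^ m1 + c1 * (1 - w) ^ (m + 1)"
  assume "\<not> c1 > 0"
  then have "c1 * (1 - d) ^ (m + 1) < 0"
    using assms(1,5) by (intro mult_neg_pos) auto
  then have "?D d \<le> 0" using assms(2,3) by (simp add: power_0_left)
  moreover have "0 \<le> ?D 1" using assms(1,4) by (simp add: power_0_left)
  moreover have "continuous_on {d..1} ?D" by (intro continuous_intros)
  ultimately obtain w where "d \<le> w" "w \<le> 1" "?D w = 0"
    using IVT'[of ?D d 0 1] assms(1) by auto
  then show False using nz[of w] by auto
qed

theorem theorem3:
  fixes d c1 c2 :: real and n n1 m m1 :: nat and f :: "real \<Rightarrow> real"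
  assumes "0 < d" and "d < 1"
    and "n \<ge> 1" and "n1 \<ge> 1" and "m1 \<ge> 1"
    and "c1 \<noteq> 0" and "c2 \<noteq> 0" and "sgn c1 = sgn c2"
    and "\<And>w. w \<in> {d..1} \<Longrightarrow>
           (w - d) ^ n + c2 * (w - d) ^ n1 * (1 - w) ^ m1 + c1 * (1 - w) ^ (m + 1) \<noteq> 0"
    and "\<And>w. w \<in> {d..1} \<Longrightarrow>
           f w = d + (w - d) ^ (n + 1) /
             ((w - d) ^ n + c2 * (w - d) ^ n1 * (1 - w) ^ m1 + c1 * (1 - w) ^ (m + 1))"
  shows "condition_C n (min m (m1 - 1)) d f"
proof -
  define D where
    "D w = (w - d) ^ n + c2 * (w - d) ^ n1 * (1 - w) ^ m1 + c1 * (1 - w) ^ (m + 1)" for w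
  have D_nz: "D w \<noteq> 0" if "w \<in> {d..1}" for w
    using assms(9)[OF that] by (simp add: D_def)
  have f_eq: "f w = d + (w - d) ^ (n + 1) / D w" if "w \<in> {d..1}" for w
    using assms(10)[OF that] by (simp add: D_def)
  have D_rat: "rational_on {d..1} D"
    unfolding D_def by (intro rational_on_intros)
  have c1: "c1 > 0"
    by (rule coefficient_pos_of_nonvanishing_denominator[OF assms(2-6) assms(9)])
  with assms(8) have c2: "c2 > 0" by (simp add: sgn_1_pos)
  define M where "M = min m (m1 - 1)"
  \<comment> \<open>The factor of \<open>D w - (w - d) ^ n\<close> left after extracting \<open>(1 - w) ^ (M + 1)\<close>.\<close>
  define r where "r w = c2 * (w - d) ^ n1 * (1 - w) ^ (m1 - (M + 1)) + c1 * (1 - w) ^ (m - M)"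
    for w
  have exps: "m1 = (M + 1) + (m1 - (M + 1))" "m + 1 = (M + 1) + (m - M)"
    using assms(5) by (auto simp: M_def)
  have D_split: "D w = (w - d) ^ n + (1 - w) ^ (M + 1) * r w" for w
  proof -
    have "(1 - w) ^ m1 = (1 - w) ^ (M + 1) * (1 - w) ^ (m1 - (M + 1))"
      "(1 - w) ^ (m + 1) = (1 - w) ^ (M + 1) * (1 - w) ^ (m - M)"
      by (metis exps(1) power_add, metis exps(2) power_add)
    then show ?thesis unfolding D_def r_def by (simp only: algebra_simps)
  qed
  define h where "h w = (- 1) ^ M * ((w - d) * r w) / D w" for w
  have h_rat: "rational_on {d..1} h"
    unfolding h_def r_def using D_rat D_nz by (intro rational_on_intros)
  have f_id: "f w = w + (w - 1) ^ (M + 1) * h w" if "w \<in> {d..1}" for w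
  proof -
    have sign: "(w - 1) ^ (M + 1) * (- 1) ^ M = - ((1 - w) ^ (M + 1))"
    proof -
      have "(w - 1) ^ (M + 1) = (- 1) ^ (M + 1) * (1 - w) ^ (M + 1)"
        by (metis minus_diff_eq power_minus)
      then show ?thesis by (simp add: power_mult_distrib[symmetric])
    qed
    have "(w - 1) ^ (M + 1) * h w = (w - 1) ^ (M + 1) * (- 1) ^ M * ((w - d) * r w) / D w"
      by (simp add: h_def mult.assoc)
    also have "\<dots> = (w - d) * ((w - d) ^ n - D w) / D w"
      unfolding sign by (simp add: D_split algebra_simps)
    also have "\<dots> = (w - d) ^ (n + 1) / D w - (w - d)"
      using D_nz[OF that] by (simp add: field_simps)
    finally show ?thesis using f_eq[OF that] by simp
  qed
  have f_rat: "rational_on {d..1} f"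
    by (rule rational_on_cong[OF _ f_eq]) (use D_rat D_nz in \<open>intro rational_on_intros\<close>)
  have h1: "(- 1) ^ M * h 1 > 0"
  proof -
    have "r 1 > 0"
    proof (cases "m \<le> m1 - 1")
      case True
      then have "r 1 = c2 * (1 - d) ^ n1 * 0 ^ (m1 - (M + 1)) + c1"
        by (simp add: r_def M_def)
      then show ?thesis using c1 c2 assms(2) by (simp add: add_nonneg_pos)
    next
      case False
      then have "m - M > 0" "m1 - (M + 1) = 0" using assms(5) by (auto simp: M_def)
      then have "r 1 = c2 * (1 - d) ^ n1" by (simp add: r_def)
      then show ?thesis using c2 assms(2) by simp
    qed
    moreover have "D 1 = (1 - d) ^ n" by (simp add: D_split)
    moreover have "(- 1) ^ M * h 1 = (1 - d) * r 1 / D 1"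
      by (simp add: h_def flip: mult.assoc power_mult_distrib)
    ultimately show ?thesis using assms(2) by simp
  qed
  have at_d: "nth_deriv_within i f {d..1} d =
      poly ((pderiv ^^ i) [:d:]) d + (if i = n + 1 then fact (n + 1) * (1 / D d) else 0)"
    if "i \<le> n + 1" for i
    by (rule nth_deriv_within_taylor)
      (use assms(2) D_rat D_nz f_eq that in \<open>auto intro!: rational_on_intros\<close>)
  have at_1: "nth_deriv_within i f {d..1} 1 =
      poly ((pderiv ^^ i) [:0, 1:]) 1 + (if i = M + 1 then fact (M + 1) * h 1 else 0)"
    if "i \<le> M + 1" for i
    by (rule nth_deriv_within_taylor) (use assms(2) h_rat f_id that in auto)
  have pderiv_const: "(pderiv ^^ i) [:a:] = 0" if "i \<ge> 1" for i and a :: real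
    using that by (induction i rule: dec_induct) (simp_all add: pderiv_pCons)
  have pderiv_id: "(pderiv ^^ i) [:0, 1 :: real:] = 0" if "i \<ge> 2" for i
    using that by (induction i rule: dec_induct) (simp_all add: pderiv_pCons numeral_2_eq_2)
  have "nth_deriv_within (M + 1) f {d..1} 1 \<noteq> 0"
  proof (cases "M = 0")
    case True
    then show ?thesis using at_1[of 1] h1 by (simp add: pderiv_pCons)
  next
    case False
    then show ?thesis using at_1[of "M + 1"] h1
      by (auto simp add: pderiv_id simp del: funpow.simps fact_Suc)
  qed
  moreover have "nth_deriv_within (n + 1) f {d..1} d \<noteq> 0"
    using at_d[of "n + 1"] D_nz[of d] assms(2) by (simp add: pderiv_const del: funpow.simps fact_Suc)
  moreover have "\<forall>i\<in>{1..n}. nth_deriv_within i f {d..1} d = 0"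
    using at_d by (simp add: pderiv_const)
  moreover have "\<forall>i\<in>{2..M}. nth_deriv_within i f {d..1} 1 = 0"
    using at_1 by (simp add: pderiv_id)
  moreover have "M \<ge> 1 \<longrightarrow> nth_deriv_within 1 f {d..1} 1 = 1"
    using at_1[of 1] by (simp add: pderiv_pCons)
  moreover have "f d = d" "f 1 = 1"
    using f_eq[of d] f_id[of 1] assms(2) by auto
  moreover have "times_differentiable_within k f {d..1} x" if "x \<in> {d..1}" for k x
    by (rule times_differentiable_within_rational[OF assms(2) f_rat that])
  ultimately have "condition_C n M d f"
    using assms(2) unfolding condition_C_def
    by (simp del: times_differentiable_within.simps)
  then show ?thesis by (simp add: M_def)
qed

end
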